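(* Let $q$ be a prime power, $m$ a positive integer, $Q = (q^m-1)/(q-1)$, and $\alpha$ a primitive element of $\mathbb{F}_{q^m}$. Let $A$ be a subset of $\mathbb{F}_{q^m}$ and $N$ a positive divisor of $q^m-1$. Then the number $M_{q,m,N}(A)$ of non-zero elements in $A$ that have multiplicative order $N$ is given by $$M_{q,m,N}(A) = \frac{1}{q^m-1}\sum_{d \mid N} \mu(d)\frac{N}{d} \left| \left\{ x \in \mathbb{F}_{q^m}^* \ : \ x^{\frac{q^m-1}{N}d} \in A \right\} \right|.$$ In particular, for $c \in \mathbb{F}_q$, the number $P_{q,m,N}(c)$ of elements $\beta \in \mathbb{F}_{q^m}^*$ with order $N$ and satisfying $\operatorname{Tr}_{\mathbb{F}_{q^m}/\mathbb{F}_q}(\beta) = c$ is given by $$P_{q,m,N}(c) = \frac{N}{q(q^m-1)}\sum_{d \mid N} \frac{\mu(d)}{d}\sum_{a \in \mathbb{F}_q}\overline{\chi_q(ac)} \sum_{x \in \mathbb{F}_{q^m}^*} \chi_{q^m} \left( a x^{\frac{q^m-1}{N}d} \right) = \frac{1}{q} \left( \phi(N) + \sum_{i=0}^{q-2} \overline{\chi_q\left( \alpha^{Qi}c \right)} \sum_{d \mid N} \mu(d)\, \eta_{Qi}^{\left( \frac{q^m-1}{N}d,\, q^m \right)} \right).$$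
   Context: $\phi$ is Euler's function, $\mu$ the Möbius function, and divisors are positive. Let $p$ be the characteristic of $\mathbb{F}_q$. The canonical additive characters are $\chi_q(x) = e^{2\pi\sqrt{-1}\operatorname{Tr}_{\mathbb{F}_{q}/\mathbb{F}_p}(x)/p}$ for $x \in \mathbb{F}_q$ and $\chi_{q^m}(z) = e^{2\pi\sqrt{-1}\operatorname{Tr}_{\mathbb{F}_{q^m}/\mathbb{F}_p}(z)/p}$ for $z\in\mathbb{F}_{q^m}$. For $d \mid q^m-1$ and $k \in \mathbb{Z}$, the $k$-th Gaussian period of type $(d,q^m)$ is $\eta_k^{(d,q^m)} = \sum_{x \in \alpha^k\langle \alpha^d\rangle} \chi_{q^m}(x)$. *)

theory Defs
  imports Complex_Main "HOL-Algebra.Algebra" "HOL-Number_Theory.Number_Theory"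
    "HOL-Computational_Algebra.Squarefree"
begin

definition moebius_mu :: "nat \<Rightarrow> int" where
  "moebius_mu n = (if squarefree n then (-1) ^ card (prime_factors n) else 0)"

(* The finite fields in play are subfields, given as subsets of the carrier, of one
   ambient finite field R. *)

definition characteristic :: "('a, 'b) ring_scheme \<Rightarrow> nat" where
  "characteristic R = group.ord (add_monoid R) \<one>\<^bsub>R\<^esub>"

definition prime_subfield :: "('a, 'b) ring_scheme \<Rightarrow> 'a set" where
  "prime_subfield R = range (\<lambda>k::nat. [k] \<cdot>\<^bsub>R\<^esub> \<one>\<^bsub>R\<^esub>)"

(* Trace from E down to F as the sum of the [E : F] conjugates x, x^|F|, x^(|F|^2), ... *)
definition field_trace :: "('a, 'b) ring_scheme \<Rightarrow> 'a set \<Rightarrow> 'a set \<Rightarrow> 'a \<Rightarrow> 'a" where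
  "field_trace R E F x =
     (\<Oplus>\<^bsub>R\<^esub> i \<in> {..<ring.dim R F E}. x [^]\<^bsub>R\<^esub> (card F ^ i))"

(* The identification of the prime subfield with {0, ..., p - 1}. *)
definition prime_subfield_rep :: "('a, 'b) ring_scheme \<Rightarrow> 'a \<Rightarrow> nat" where
  "prime_subfield_rep R y = (THE k. k < characteristic R \<and> [k] \<cdot>\<^bsub>R\<^esub> \<one>\<^bsub>R\<^esub> = y)"

(* Canonical additive character of the subfield E of R. *)
definition add_character :: "('a, 'b) ring_scheme \<Rightarrow> 'a set \<Rightarrow> 'a \<Rightarrow> complex" where
  "add_character R E x =
     exp (2 * of_real pi * \<i> *
          of_nat (prime_subfield_rep R (field_trace R E (prime_subfield R) x)) /
          of_nat (characteristic R))"

(* Qualified because HOL-Algebra declares a second, identical copy of this constant. *)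
abbreviation mult_group :: "('a, 'b) ring_scheme \<Rightarrow> 'a monoid" where
  "mult_group R \<equiv> Multiplicative_Group.mult_of R"

definition primitive_element :: "('a, 'b) ring_scheme \<Rightarrow> 'a \<Rightarrow> bool" where
  "primitive_element R \<alpha> \<longleftrightarrow>
     \<alpha> \<in> carrier (mult_group R) \<and> generate (mult_group R) {\<alpha>} = carrier (mult_group R)"

(* The k-th period of type (d, |R|), for d dividing |R| - 1, with respect to \<alpha>. *)
definition gaussian_period :: "('a, 'b) ring_scheme \<Rightarrow> 'a \<Rightarrow> nat \<Rightarrow> int \<Rightarrow> complex" where
  "gaussian_period R \<alpha> d k =
     (\<Sum>x \<in> (\<alpha> [^]\<^bsub>mult_group R\<^esub> k) <#\<^bsub>mult_group R\<^esub>
             generate (mult_group R) {\<alpha> [^]\<^bsub>mult_group R\<^esub> d}.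
        add_character R (carrier R) x)"

end

theory Submission
  imports Defs
begin

text \<open>
  The multiplicative group of a field with \<open>q ^ m\<close> elements is cyclic of order \<open>M = q ^ m - 1\<close>.  For
  \<open>e\<close> dividing \<open>M\<close> the map \<open>x \<mapsto> x ^ e\<close> takes each value in \<open>{y. y ^ (M / e) = 1}\<close> exactly \<open>e\<close> times
  (\<open>power_map_fibers\<close>).  With \<open>e = M / N * d\<close> the image is \<open>{y. y ^ (N / d) = 1}\<close>, and a nonzero \<open>y\<close>
  lies in it iff \<open>ord y\<close> divides \<open>N\<close> and \<open>d\<close> divides \<open>N / ord y\<close>.  Hence weighting by \<open>\<mu>(d)\<close> and
  summing over \<open>d\<close> leaves precisely the elements of order \<open>N\<close> (\<open>sum_over_elements_of_order\<close>).  The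
  count in a set \<open>A\<close> is the case of an indicator function.

  To count by trace, the indicator of \<open>Tr x = c\<close> is written as
  \<open>1 / q * (\<Sum>a\<in>K. cnj (\<chi>\<^sub>K (a * c)) * \<chi>\<^sub>L (a * x))\<close> (\<open>sum_character_trace_indicator\<close>).  This rests on
  \<open>\<chi>\<^sub>L (a * x) = \<chi>\<^sub>K (a * Tr x)\<close>, that is, on transitivity and linearity of the trace, and on the
  orthogonality of the characters of \<open>K\<close>, which needs the absolute trace of \<open>K\<close> to be nonzero.  The
  traces are handled as sums of conjugates: additivity of Frobenius makes them additive and invariant
  under Frobenius, hence valued in the base field, and a degree bound shows that they do not vanish.
  The same power map lemma finally turns the inner sums for \<open>a \<noteq> 0\<close> into multiples of Gaussian
  periods, while \<open>a = 0\<close> gives \<open>\<phi>(N)\<close> (\<open>trace_sum_eq_gaussian_periods\<close>).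
\<close>

section \<open>The Moebius function\<close>

lemma moebius_mu_1 [simp]: "moebius_mu 1 = 1" "moebius_mu (Suc 0) = 1"
  by (simp_all add: moebius_mu_def)

lemma moebius_mu_prime_mult:
  assumes "Factorial_Ring.prime p" and "\<not> p dvd e"
  shows "moebius_mu (p * e) = - moebius_mu e"
proof -
  have e: "e \<noteq> 0" "p \<noteq> 0" using assms by (auto intro!: Nat.gr0I)
  have cop: "coprime p e" using assms prime_imp_coprime by blast
  have "prime_factors (p * e) = insert p (prime_factors e)"
    using assms e by (auto simp: prime_factors_dvd prime_dvd_mult_iff primes_dvd_imp_eq)
  moreover have "p \<notin> prime_factors e" using assms by auto
  ultimately have "card (prime_factors (p * e)) = Suc (card (prime_factors e))" by simp
  moreover have "squarefree (p * e) \<longleftrightarrow> squarefree e"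
    using assms cop squarefree_mult_coprime[of p e] squarefree_multD[of p e] squarefree_prime[of p]
    by auto
  ultimately show ?thesis by (simp add: moebius_mu_def)
qed

text \<open>Only squarefree divisors contribute.  For a prime \<open>p\<close> dividing \<open>n\<close>, multiplication by \<open>p\<close> pairs
  the squarefree divisors prime to \<open>p\<close> with those divisible by \<open>p\<close> and flips the sign.\<close>

lemma sum_moebius_mu_divisors:
  assumes "n > 0"
  shows "(\<Sum>d | d dvd n. moebius_mu d) = (if n = 1 then 1 else 0)"
proof (cases "n = 1")
  case True
  then show ?thesis by simp
next
  case False
  then obtain p where p: "Factorial_Ring.prime p" "p dvd n" using prime_factor_nat by blast
  define D where "D = {d. d dvd n \<and> squarefree d}"
  have fin: "finite {d. d dvd n}" using assms by simp
  then have finD: "finite D" by (rule rev_finite_subset) (auto simp: D_def)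
  have D1: "{d \<in> D. p dvd d} = (*) p ` {d \<in> D. \<not> p dvd d}"
  proof (intro equalityI subsetI)
    fix d assume d: "d \<in> {d \<in> D. p dvd d}"
    then obtain e where e: "d = p * e" by auto
    have "\<not> p dvd e"
    proof
      assume "p dvd e"
      then have "p ^ 2 dvd d" using e by (auto simp: power2_eq_square mult_dvd_mono)
      then show False using d p not_squarefreeI[of p d] by (auto simp: D_def dest: prime_gt_1_nat)
    qed
    then show "d \<in> (*) p ` {d \<in> D. \<not> p dvd d}"
      using d e by (auto simp: D_def dest: dvd_mult_right squarefree_multD)
  next
    fix d assume "d \<in> (*) p ` {d \<in> D. \<not> p dvd d}"
    then obtain e where e: "d = p * e" "e \<in> D" "\<not> p dvd e" by auto
    have "coprime p e" using e p prime_imp_coprime by blast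
    then show "d \<in> {d \<in> D. p dvd d}"
      using e p by (auto simp: D_def divides_mult squarefree_mult_coprime squarefree_prime)
  qed
  have "inj_on ((*) p) {d \<in> D. \<not> p dvd d}" using p by (auto simp: inj_on_def)
  then have "(\<Sum>d | d \<in> D \<and> p dvd d. moebius_mu d) = (\<Sum>d | d \<in> D \<and> \<not> p dvd d. - moebius_mu d)"
    unfolding D1 by (subst sum.reindex) (auto intro!: sum.cong simp: moebius_mu_prime_mult p)
  moreover have "(\<Sum>d\<in>D. moebius_mu d) =
      (\<Sum>d | d \<in> D \<and> p dvd d. moebius_mu d) + (\<Sum>d | d \<in> D \<and> \<not> p dvd d. moebius_mu d)"
    by (subst sum.union_disjoint[symmetric]) (use finD in \<open>auto intro!: sum.cong\<close>)
  moreover have "(\<Sum>d | d dvd n. moebius_mu d) = (\<Sum>d\<in>D. moebius_mu d)"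
    by (rule sum.mono_neutral_right) (use fin in \<open>auto simp: D_def moebius_mu_def\<close>)
  ultimately show ?thesis using False by (simp add: sum_negf)
qed

lemma phi'_eq_totient: "phi' n = totient n"
  unfolding phi'_def totient_def totatives_def
  by (rule arg_cong[where f = card]) auto

section \<open>Power maps and elements of given order\<close>

locale finite_field = field R for R (structure) +
  assumes finite_carrier [simp]: "finite (carrier R)"
begin

abbreviation nonzero :: "'a set" where "nonzero \<equiv> carrier R - {\<zero>}"
abbreviation units_order :: nat where "units_order \<equiv> order R - 1"

lemma card_nonzero: "card nonzero = units_order"
  by (simp add: order_def)

lemma order_gt_1: "order R > 1"
proof -
  have "card {\<zero>, \<one>} \<le> card (carrier R)" by (rule card_mono) auto
  then show ?thesis by (simp add: order_def)
qed

lemma mult_group_is_group: "group (mult_group R)"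
  by (rule field_mult_group)

lemma nonzero_nat_pow: "x \<in> nonzero \<Longrightarrow> x [^] (k::nat) \<in> nonzero"
  using monoid.nat_pow_closed[OF group.is_monoid[OF mult_group_is_group], of x k]
  by (simp add: Multiplicative_Group.nat_pow_mult_of)

lemma nonzero_pow_units_order: "x \<in> nonzero \<Longrightarrow> x [^] units_order = \<one>"
  using group.pow_order_eq_1[OF mult_group_is_group, of x] order_mult_of
  by (simp add: Multiplicative_Group.nat_pow_mult_of)

lemma pow_eq_one_iff_ord_dvd:
  "x \<in> nonzero \<Longrightarrow> x [^] k = \<one> \<longleftrightarrow> group.ord (mult_group R) x dvd k"
  using group.pow_eq_id[OF mult_group_is_group, of x k] by (simp add: Multiplicative_Group.nat_pow_mult_of)

lemma card_roots_of_unity_le: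
  assumes "d > 0"
  shows "card {x \<in> nonzero. x [^] d = \<one>} \<le> d"
proof -
  have "card {x \<in> nonzero. x [^] d = \<one>} \<le> card {x \<in> carrier R. x [^] d = \<one>}"
    by (rule card_mono) auto
  also have "\<dots> \<le> d" using num_roots_le_deg[of d] assms by simp
  finally show ?thesis .
qed

text \<open>The map \<open>x \<mapsto> x ^ e\<close> is a homomorphism of a group of order \<open>e * h\<close>.  Its kernel consists of roots of
  \<open>X ^ e - 1\<close> and its image of roots of \<open>X ^ h - 1\<close>, so they have at most \<open>e\<close> and \<open>h\<close> elements.
  Since the two cardinalities multiply to \<open>e * h\<close>, both bounds are attained.\<close>

lemma power_map_fibers:
  assumes "e dvd units_order"
  defines "H \<equiv> {y \<in> nonzero. y [^] (units_order div e) = \<one>}"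
  shows "(\<lambda>x. x [^] e) ` nonzero = H"
    and "\<And>y. y \<in> H \<Longrightarrow> card {x \<in> nonzero. x [^] e = y} = e"
proof -
  define h where "h = units_order div e"
  have M: "units_order = e * h" using assms by (simp add: h_def)
  have pos: "e > 0" "h > 0" using M order_gt_1 by (auto intro!: Nat.gr0I)
  let ?I = "(\<lambda>x. x [^] e) ` nonzero"
  let ?k = "card {x \<in> nonzero. x [^] e = \<one>}"
  have fib: "card {x \<in> nonzero. x [^] e = y} = ?k" if "y \<in> ?I" for y
  proof -
    obtain z where z: "z \<in> nonzero" "y = z [^] e" using \<open>y \<in> ?I\<close> by auto
    have iz: "inv z \<in> nonzero" "z \<otimes> inv z = \<one>" "inv z \<otimes> z = \<one>"
      using z field_Units Units_inv_Units Units_r_inv Units_l_inv by auto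
    have "{x \<in> nonzero. x [^] e = y} = (\<lambda>x. z \<otimes> x) ` {x \<in> nonzero. x [^] e = \<one>}"
    proof (intro equalityI subsetI)
      fix x assume x: "x \<in> {x \<in> nonzero. x [^] e = y}"
      have "inv z \<otimes> x \<in> nonzero" using x iz by (auto simp: integral_iff)
      moreover have "(inv z \<otimes> x) [^] e = (inv z \<otimes> z) [^] e"
      proof -
        have "(inv z \<otimes> x) [^] e = inv z [^] e \<otimes> z [^] e"
          using x z iz by (simp add: nat_pow_distrib)
        moreover have "(inv z \<otimes> z) [^] e = inv z [^] e \<otimes> z [^] e"
          using z(1) iz(1) by (intro nat_pow_distrib) auto
        ultimately show ?thesis by (simp only:)
      qed
      moreover have "x = z \<otimes> (inv z \<otimes> x)"
        using x z iz by (simp add: m_assoc[symmetric])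
      ultimately show "x \<in> (\<lambda>x. z \<otimes> x) ` {x \<in> nonzero. x [^] e = \<one>}"
        using iz by auto
    next
      fix x assume "x \<in> (\<lambda>x. z \<otimes> x) ` {x \<in> nonzero. x [^] e = \<one>}"
      then show "x \<in> {x \<in> nonzero. x [^] e = y}"
        using z by (auto simp: integral_iff nat_pow_distrib)
    qed
    moreover have "inj_on (\<lambda>x. z \<otimes> x) {x \<in> nonzero. x [^] e = \<one>}"
      using z by (auto simp: inj_on_def m_lcancel)
    ultimately show ?thesis by (simp add: card_image)
  qed
  have sub: "?I \<subseteq> H"
  proof
    fix y assume "y \<in> ?I"
    then obtain x where x: "x \<in> nonzero" "y = x [^] e" by auto
    have "y [^] h = x [^] units_order" using x M by (simp add: nat_pow_pow)
    then show "y \<in> H" using nonzero_nat_pow x nonzero_pow_units_order by (auto simp: H_def h_def)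
  qed
  have finH: "finite H" by (simp add: H_def)
  have cH: "card H \<le> h" using card_roots_of_unity_le[OF pos(2)] by (simp add: H_def h_def)
  have ck: "?k \<le> e" by (rule card_roots_of_unity_le[OF pos(1)])
  have "card nonzero = (\<Sum>y\<in>?I. card {x \<in> nonzero. x [^] e = y})"
    using sum.image_gen[of nonzero "\<lambda>_. 1::nat" "\<lambda>x. x [^] e"] by simp
  also have "\<dots> = card ?I * ?k" using fib by simp
  finally have eq: "e * h = card ?I * ?k" using M card_nonzero by simp
  have cI: "card ?I \<le> h" using card_mono[OF finH sub] cH by simp
  have "e * h \<le> h * ?k" using eq cI by simp
  then have k: "?k = e" using ck pos by (simp add: mult.commute)
  then have "card ?I = h" using eq pos by simp
  then show I: "?I = H" using card_subset_eq[OF finH sub] card_mono[OF finH sub] cH by simp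
  fix y assume "y \<in> H"
  then show "card {x \<in> nonzero. x [^] e = y} = e" using fib I k by simp
qed

lemma sum_power_map:
  fixes f :: "'a \<Rightarrow> 'c::comm_semiring_1"
  assumes "e dvd units_order"
  shows "(\<Sum>x\<in>nonzero. f (x [^] e)) =
    of_nat e * (\<Sum>y | y \<in> nonzero \<and> y [^] (units_order div e) = \<one>. f y)"
proof -
  let ?H = "{y \<in> nonzero. y [^] (units_order div e) = \<one>}"
  have "(\<Sum>x\<in>nonzero. f (x [^] e)) =
      (\<Sum>y\<in>(\<lambda>x. x [^] e) ` nonzero. \<Sum>x | x \<in> nonzero \<and> x [^] e = y. f (x [^] e))"
    by (rule sum.image_gen) simp
  also have "\<dots> = (\<Sum>y\<in>?H. \<Sum>x | x \<in> nonzero \<and> x [^] e = y. f y)"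
    by (rule sum.cong) (auto simp: power_map_fibers(1)[OF assms])
  also have "\<dots> = (\<Sum>y\<in>?H. of_nat e * f y)"
    using power_map_fibers(2)[OF assms] by (intro sum.cong) auto
  finally show ?thesis by (simp add: sum_distrib_left)
qed

text \<open>The condition \<open>y ^ (N / d) = 1\<close> says that \<open>d\<close> divides \<open>N / ord y\<close>, so this is Moebius inversion
  as an indicator of the elements of order \<open>N\<close>.\<close>

lemma sum_moebius_mu_ord:
  assumes "N > 0" and y: "y \<in> nonzero"
  shows "(\<Sum>d | d dvd N \<and> y [^] (N div d) = \<one>. moebius_mu d) =
    (if group.ord (mult_group R) y = N then 1 else 0)"
proof -
  let ?n = "group.ord (mult_group R) y"
  have n: "?n > 0"
    using group.ord_ge_1[OF mult_group_is_group] y by (simp add: Suc_le_eq)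
  show ?thesis
  proof (cases "?n dvd N")
    case True
    then obtain k where k: "N = ?n * k" by auto
    have "{d. d dvd N \<and> y [^] (N div d) = \<one>} = {d. d dvd k}"
    proof (intro Collect_cong iffI)
      fix d assume d: "d dvd N \<and> y [^] (N div d) = \<one>"
      then have "?n dvd N div d" using pow_eq_one_iff_ord_dvd y by blast
      then obtain j where "N div d = ?n * j" by auto
      then have "?n * k = ?n * (d * j)" using d k by (metis dvd_mult_div_cancel mult.left_commute)
      then show "d dvd k" using n by simp
    next
      fix d assume "d dvd k"
      then obtain j where j: "k = d * j" by auto
      have "d > 0" using j k assms by (auto intro!: Nat.gr0I)
      have N: "N = d * (?n * j)" using j k by simp
      have "N div d = ?n * j" by (subst N) (use \<open>d > 0\<close> in simp)
      then show "d dvd N \<and> y [^] (N div d) = \<one>"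
        using N pow_eq_one_iff_ord_dvd[OF y] by (metis dvd_triv_left)
    qed
    moreover have "k > 0" using k assms by (auto intro!: Nat.gr0I)
    moreover have "k = 1 \<longleftrightarrow> ?n = N" using k n by auto
    ultimately show ?thesis using sum_moebius_mu_divisors[of k] by simp
  next
    case False
    have "\<not> ?n dvd N div d" if "d dvd N" for d
      using dvd_mult2[of ?n "N div d" d] that False by auto
    then have "{d. d dvd N \<and> y [^] (N div d) = \<one>} = {}"
      using pow_eq_one_iff_ord_dvd[OF y] by blast
    moreover have "?n \<noteq> N" using False by auto
    ultimately show ?thesis by (metis sum.empty)
  qed
qed

text \<open>The weighted form of the counting formula, which yields the count in an arbitrary set (\<open>f\<close> an
  indicator), the identity \<open>\<phi>(N) = N * (\<Sum>d dvd N. \<mu>(d) / d)\<close> (\<open>f = 1\<close>), and the count by trace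
  (\<open>f\<close> a character sum).  With \<open>M\<close> the order of the multiplicative group, the exponent \<open>M / N * d\<close> is chosen so
  that the power map has image \<open>{y. y ^ (N / d) = 1}\<close>; after summing over this image and interchanging the
  sums, each \<open>y\<close> carries the indicator of having order \<open>N\<close>.\<close>

lemma sum_over_elements_of_order:
  fixes f :: "'a \<Rightarrow> 'c::field_char_0"
  assumes N: "N > 0" "N dvd units_order"
  shows "(\<Sum>x | x \<in> nonzero \<and> group.ord (mult_group R) x = N. f x) =
    of_nat N / of_nat units_order * (\<Sum>d | d dvd N. of_int (moebius_mu d) / of_nat d *
       (\<Sum>x\<in>nonzero. f (x [^] (units_order div N * d))))"
proof -
  let ?M = units_order
  have Mpos: "?M > 0" using order_gt_1 by simp
  have finN: "finite {d. d dvd N}" using N by simp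
  have step: "of_int (moebius_mu d) / of_nat d * (\<Sum>x\<in>nonzero. f (x [^] (?M div N * d))) =
      of_nat ?M / of_nat N * (\<Sum>y\<in>nonzero. if y [^] (N div d) = \<one> then of_int (moebius_mu d) * f y else 0)"
    if dN: "d dvd N" for d
  proof -
    have d: "d > 0" using dN N by (auto intro!: Nat.gr0I)
    obtain k where k: "?M = N * k" using N by auto
    obtain j where j: "N = d * j" using dN by auto
    have M: "?M = (?M div N * d) * (N div d)" using k j N d by simp
    have e: "?M div N * d dvd ?M" using M by (metis dvd_triv_left)
    have "?M div N * d > 0" using M Mpos by (metis nat_0_less_mult_iff)
    then have e': "?M div (?M div N * d) = N div d" using M
      by (metis nonzero_mult_div_cancel_left not_gr_zero)
    have c: "(of_nat (?M div N * d) :: 'c) = of_nat ?M / of_nat N * of_nat d"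
    proof -
      have "?M div N = k" using k N by simp
      then show ?thesis unfolding k using N(1) by simp
    qed
    have "of_int (moebius_mu d) / of_nat d * (\<Sum>x\<in>nonzero. f (x [^] (?M div N * d))) =
        of_nat ?M / of_nat N * (of_int (moebius_mu d) * (\<Sum>y | y \<in> nonzero \<and> y [^] (N div d) = \<one>. f y))"
      unfolding sum_power_map[OF e] e' c using d by (simp del: of_nat_diff)
    also have "of_int (moebius_mu d) * (\<Sum>y | y \<in> nonzero \<and> y [^] (N div d) = \<one>. f y) =
        (\<Sum>y\<in>nonzero. if y [^] (N div d) = \<one> then of_int (moebius_mu d) * f y else 0)"
      unfolding sum_distrib_left by (rule sum.inter_filter) simp
    finally show ?thesis .
  qed
  have "(\<Sum>d | d dvd N. of_int (moebius_mu d) / of_nat d * (\<Sum>x\<in>nonzero. f (x [^] (?M div N * d)))) =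
      of_nat ?M / of_nat N * (\<Sum>d | d dvd N. \<Sum>y\<in>nonzero.
         if y [^] (N div d) = \<one> then of_int (moebius_mu d) * f y else 0)"
    unfolding sum_distrib_left[of "of_nat ?M / of_nat N"] using step by (intro sum.cong) (auto simp: sum_distrib_left)
  also have "(\<Sum>d | d dvd N. \<Sum>y\<in>nonzero.
         if y [^] (N div d) = \<one> then of_int (moebius_mu d) * f y else 0) =
      (\<Sum>y\<in>nonzero. \<Sum>d | d dvd N.
         if y [^] (N div d) = \<one> then of_int (moebius_mu d) * f y else 0)"
    by (rule sum.swap)
  also have "\<dots> = (\<Sum>y\<in>nonzero. if group.ord (mult_group R) y = N then f y else 0)"
  proof (rule sum.cong)
    fix y assume y: "y \<in> nonzero"
    have "(\<Sum>d | d dvd N. if y [^] (N div d) = \<one> then of_int (moebius_mu d) * f y else 0) =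
       of_int (\<Sum>d | d dvd N \<and> y [^] (N div d) = \<one>. moebius_mu d) * f y"
      unfolding of_int_sum sum_distrib_right
      using sum.inter_filter[OF finN, of "\<lambda>d. of_int (moebius_mu d) * f y" "\<lambda>d. y [^] (N div d) = \<one>"]
      by simp
    also have "\<dots> = (if group.ord (mult_group R) y = N then f y else 0)"
      unfolding sum_moebius_mu_ord[OF N(1) y] by simp
    finally show "(\<Sum>d | d dvd N. if y [^] (N div d) = \<one> then of_int (moebius_mu d) * f y else 0) =
       (if group.ord (mult_group R) y = N then f y else 0)" .
  qed simp
  also have "\<dots> = (\<Sum>x | x \<in> nonzero \<and> group.ord (mult_group R) x = N. f x)"
    by (simp add: sum.inter_filter[symmetric])
  finally show ?thesis using N Mpos by (simp add: field_simps)
qed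

lemma card_elements_of_order_in:
  assumes N: "N > 0" "N dvd units_order" and A: "A \<subseteq> carrier R"
  shows "of_nat (card {x \<in> A. x \<noteq> \<zero> \<and> group.ord (mult_group R) x = N}) =
    (1 / of_nat units_order * (\<Sum>d | d dvd N. of_int (moebius_mu d) * (of_nat N / of_nat d) *
       of_nat (card {x \<in> nonzero. x [^] (units_order div N * d) \<in> A})) :: 'c::field_char_0)"
proof -
  let ?f = "\<lambda>x. if x \<in> A then 1 else 0 :: 'c"
  have "of_nat (card {x \<in> A. x \<noteq> \<zero> \<and> group.ord (mult_group R) x = N}) =
     (\<Sum>x | x \<in> nonzero \<and> group.ord (mult_group R) x = N. ?f x)"
    using A by (subst sum.inter_filter[symmetric]) (auto intro!: arg_cong[where f = card])
  also have "\<dots> = of_nat N / of_nat units_order * (\<Sum>d | d dvd N. of_int (moebius_mu d) / of_nat d *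
       (\<Sum>x\<in>nonzero. ?f (x [^] (units_order div N * d))))"
    by (rule sum_over_elements_of_order[OF N])
  also have "\<dots> = of_nat N / of_nat units_order * (\<Sum>d | d dvd N. of_int (moebius_mu d) / of_nat d *
       of_nat (card {x \<in> nonzero. x [^] (units_order div N * d) \<in> A}))"
    by (simp add: sum.inter_filter[symmetric])
  finally show ?thesis by (simp add: sum_distrib_left field_simps)
qed

text \<open>A cyclic group whose order is a multiple of \<open>N\<close> has \<open>\<phi>(N)\<close> elements of order \<open>N\<close>, so the identity is
  the case \<open>f = 1\<close> of the weighted counting formula.\<close>

lemma totient_eq_moebius_sum:
  assumes N: "N > 0" "N dvd units_order"
  shows "(of_nat (totient N) :: 'c::field_char_0) =
    of_nat N * (\<Sum>d | d dvd N. of_int (moebius_mu d) / of_nat d)"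
proof -
  have Mpos: "units_order > 0" using order_gt_1 by simp
  let ?S = "{x \<in> nonzero. group.ord (mult_group R) x = N}"
  obtain g where g: "g \<in> nonzero" "group.ord (mult_group R) g = units_order"
  proof -
    interpret G: group "mult_group R" by (rule mult_group_is_group)
    obtain g where g: "g \<in> carrier (mult_group R)"
      "carrier (mult_group R) = {g [^] i | i::nat. i \<in> UNIV}"
      using finite_field_mult_group_has_gen by auto
    then have "generate (mult_group R) {g} = carrier (mult_group R)"
      using G.generate_pow_on_finite_carrier[OF finite_mult_of[OF finite_carrier] g(1)]
      by (simp add: Multiplicative_Group.nat_pow_mult_of)
    then have "G.ord g = order (mult_group R)"
      using G.generate_pow_card[OF g(1)] by (simp add: order_def)
    then show ?thesis using that g order_mult_of by simp
  qed
  have "\<exists>a\<in>carrier (mult_group R). group.ord (mult_group R) a = N"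
  proof (rule bexI)
    show "group.ord (mult_group R) (g [^] (units_order div N)) = N"
    proof -
      obtain k where k: "units_order = N * k" using N by auto
      then have "k > 0" "units_order div N = k" using Mpos N by (auto intro!: Nat.gr0I)
      then show ?thesis
        using group.ord_pow[OF mult_group_is_group, of g k] g k
        by (simp add: Multiplicative_Group.nat_pow_mult_of)
    qed
    show "g [^] (units_order div N) \<in> carrier (mult_group R)"
      using nonzero_nat_pow g by simp
  qed
  then have "card ?S = totient N"
    using num_elems_of_ord_eq_phi'[of N] N order_mult_of by (simp add: phi'_eq_totient)
  then have "of_nat (totient N) = (\<Sum>x\<in>?S. 1 :: 'c)" by simp
  also have "\<dots> = of_nat N / of_nat units_order * (\<Sum>d | d dvd N. of_int (moebius_mu d) / of_nat d *
       of_nat units_order)"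
    by (subst sum_over_elements_of_order[OF N]) (simp add: card_nonzero del: of_nat_diff)
  also have "\<dots> = of_nat N * (\<Sum>d | d dvd N. of_int (moebius_mu d) / of_nat d)"
    using Mpos unfolding sum_distrib_right[symmetric] by simp
  finally show ?thesis .
qed

end

section \<open>The binomial theorem and cardinalities of vector spaces\<close>

lemma (in cring) binomial_expansion:
  assumes x: "x \<in> carrier R" and y: "y \<in> carrier R"
  shows "(x \<oplus> y) [^] (n::nat) =
    (\<Oplus>k\<in>{..n}. add_pow R (n choose k) (x [^] k \<otimes> y [^] (n - k)))"
proof (induction n)
  case 0
  then show ?case using x y by simp
next
  case (Suc n)
  define t where "t k = x [^] k \<otimes> y [^] (n - k)" for k
  have t [simp]: "t k \<in> carrier R" for k using x y by (simp add: t_def)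
  have tx: "t k \<otimes> x = x [^] Suc k \<otimes> y [^] (n - k)" for k
    using x y by (simp add: t_def m_ac)
  have ty: "t k \<otimes> y = x [^] k \<otimes> y [^] (Suc n - k)" if "k \<le> n" for k
    using x y that by (simp add: t_def m_ac Suc_diff_le)
  let ?S = "\<Oplus>k\<in>{..n}. add_pow R (n choose k) (t k)"
  have "?S \<otimes> x = (\<Oplus>k\<in>{..n}. add_pow R (n choose k) (t k \<otimes> x))"
    using x by (simp add: finsum_ldistr add_pow_ldistr)
  then have Sx: "?S \<otimes> x = (\<Oplus>k\<in>{..n}. add_pow R (n choose k) (x [^] Suc k \<otimes> y [^] (n - k)))"
    by (simp only: tx)
  have "?S \<otimes> y = (\<Oplus>k\<in>{..n}. add_pow R (n choose k) (t k \<otimes> y))"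
    using y by (simp add: finsum_ldistr add_pow_ldistr)
  also have "\<dots> = (\<Oplus>k\<in>{..n}. add_pow R (n choose k) (x [^] k \<otimes> y [^] (Suc n - k)))"
    using x y by (intro finsum_cong') (auto simp: ty)
  \<comment> \<open>The added term has coefficient \<open>n choose Suc n = 0\<close>; it makes room for shifting the index by one.\<close>
  also have "\<dots> = (\<Oplus>k\<in>{..Suc n}. add_pow R (n choose k) (x [^] k \<otimes> y [^] (Suc n - k)))"
    using x y by (subst finsum_Suc) (auto simp: binomial_eq_0)
  also have "\<dots> = (\<Oplus>k\<in>{..n}. add_pow R (n choose Suc k) (x [^] Suc k \<otimes> y [^] (n - k))) \<oplus> y [^] Suc n"
    using x y by (subst finsum_Suc2) auto
  finally have Sy: "?S \<otimes> y = \<dots>" .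
  have "(\<Oplus>k\<in>{..Suc n}. add_pow R (Suc n choose k) (x [^] k \<otimes> y [^] (Suc n - k))) =
      (\<Oplus>k\<in>{..n}. add_pow R (Suc n choose Suc k) (x [^] Suc k \<otimes> y [^] (n - k))) \<oplus> y [^] Suc n"
    using x y by (subst finsum_Suc2) auto
  also have "(\<Oplus>k\<in>{..n}. add_pow R (Suc n choose Suc k) (x [^] Suc k \<otimes> y [^] (n - k))) =
      (\<Oplus>k\<in>{..n}. add_pow R (n choose k) (x [^] Suc k \<otimes> y [^] (n - k)) \<oplus>
         add_pow R (n choose Suc k) (x [^] Suc k \<otimes> y [^] (n - k)))"
    using x y by (intro finsum_cong') (auto simp: add.nat_pow_mult)
  also have "\<dots> = ?S \<otimes> x \<oplus> (\<Oplus>k\<in>{..n}. add_pow R (n choose Suc k) (x [^] Suc k \<otimes> y [^] (n - k)))"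
    unfolding Sx using x y by (intro finsum_addf) auto
  finally have "(\<Oplus>k\<in>{..Suc n}. add_pow R (Suc n choose k) (x [^] k \<otimes> y [^] (Suc n - k))) =
      ?S \<otimes> x \<oplus> ?S \<otimes> y"
    unfolding Sy using x y by (simp add: a_assoc del: nat_pow_Suc)
  also have "\<dots> = (x \<oplus> y) [^] Suc n"
    using x y Suc.IH by (simp add: r_distr t_def)
  finally show ?case ..
qed

text \<open>Coordinates with respect to a basis identify \<open>E\<close> with the lists of length \<open>n\<close> over \<open>F\<close>.\<close>

lemma (in ring) card_subspace:
  assumes F: "subfield F R" "finite F" and "dimension n F E"
  shows "card E = card F ^ n"
proof -
  obtain Vs where Vs: "set Vs \<subseteq> carrier R" "independent F Vs" "length Vs = n" "Span F Vs = E"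
    using exists_base[OF F(1) assms(3)] by blast
  have "bij_betw (\<lambda>Ks. combine Ks Vs) {Ks. set Ks \<subseteq> F \<and> length Ks = n} E"
    unfolding bij_betw_def
  proof
    show "(\<lambda>Ks. combine Ks Vs) ` {Ks. set Ks \<subseteq> F \<and> length Ks = n} = E"
      using Span_eq_combine_set_length_version[OF F(1) Vs(1)] Vs(3,4) by auto
    show "inj_on (\<lambda>Ks. combine Ks Vs) {Ks. set Ks \<subseteq> F \<and> length Ks = n}"
    proof (rule inj_onI)
      fix Ks Ks' assume *: "Ks \<in> {Ks. set Ks \<subseteq> F \<and> length Ks = n}"
        "Ks' \<in> {Ks. set Ks \<subseteq> F \<and> length Ks = n}" "combine Ks Vs = combine Ks' Vs"
      have "combine Ks Vs \<in> Span F Vs"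
        using Span_eq_combine_set_length_version[OF F(1) Vs(1)] Vs(3) * by auto
      from unique_decomposition[OF F(1) Vs(2) this] show "Ks = Ks'"
        using * Vs(3) by auto
    qed
  qed
  from bij_betw_same_card[OF this] show ?thesis
    using card_lists_length_eq[OF F(2), of n] by simp
qed

lemma (in ring) card_subfield_tower:
  assumes F: "subfield F R" and E: "subfield E R" and "F \<subseteq> E" and "finite E"
  shows "card E = card F ^ dim F E"
proof -
  have subE: "E \<subseteq> carrier R" using subfieldE(3)[OF E] .
  obtain Us where Us: "set Us = E" using finite_list[OF \<open>finite E\<close>] by blast
  have "Span F Us = E"
  proof
    have "subgroup E (add_monoid R)" using subfieldE(1)[OF E] by (rule subring.axioms(1))
    moreover have "F <#> set Us \<subseteq> E"
      using \<open>F \<subseteq> E\<close> Us subringE(6)[OF subfieldE(1)[OF E]] by (auto simp: set_mult_def)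
    ultimately show "Span F Us \<subseteq> E" using Span_min[OF F] subE Us by blast
    show "E \<subseteq> Span F Us" using Span_base_incl[OF F] subE Us by blast
  qed
  then have "finite_dimension F E" using Span_finite_dimension[OF F, of Us] subE Us by simp
  then have "dimension (dim F E) F E" using finite_dimensionE[OF F] by (simp add: over_def)
  then show ?thesis using card_subspace[OF F] finite_subset[OF \<open>F \<subseteq> E\<close> \<open>finite E\<close>] by blast
qed

section \<open>Sums of conjugates\<close>

text \<open>With \<open>a = card F\<close> and \<open>n = [E : F]\<close> this is the trace.  Keeping \<open>a\<close> and \<open>n\<close> free allows inductions on
  \<open>n\<close> in which no field of degree \<open>n\<close> has to exist.\<close>

definition conjugate_sum :: "('a, 'b) ring_scheme \<Rightarrow> nat \<Rightarrow> nat \<Rightarrow> 'a \<Rightarrow> 'a" where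
  "conjugate_sum R a n x = (\<Oplus>\<^bsub>R\<^esub>i\<in>{..<n}. x [^]\<^bsub>R\<^esub> (a ^ i))"

lemma field_trace_eq_conjugate_sum:
  "field_trace R E F x = conjugate_sum R (card F) (ring.dim R F E) x"
  by (simp add: field_trace_def conjugate_sum_def)

context cring
begin

lemma conjugate_sum_closed [simp]:
  "x \<in> carrier R \<Longrightarrow> conjugate_sum R a n x \<in> carrier R"
  by (simp add: conjugate_sum_def)

lemma conjugate_sum_0 [simp]: "conjugate_sum R a 0 x = \<zero>"
  by (simp add: conjugate_sum_def)

lemma conjugate_sum_Suc [simp]:
  "x \<in> carrier R \<Longrightarrow> conjugate_sum R a (Suc n) x = conjugate_sum R a n x \<oplus> x [^] (a ^ n)"
  by (simp add: conjugate_sum_def lessThan_Suc a_comm)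

lemma conjugate_sum_add_index:
  assumes "x \<in> carrier R"
  shows "conjugate_sum R a (k + n) x = conjugate_sum R a k x \<oplus> conjugate_sum R a n (x [^] (a ^ k))"
  using assms by (induction n) (simp_all add: a_assoc nat_pow_pow power_add)

lemma conjugate_sum_smult:
  assumes "x \<in> carrier R" and "c \<in> carrier R" and "c [^] a = c"
  shows "conjugate_sum R a n (c \<otimes> x) = c \<otimes> conjugate_sum R a n x"
proof -
  have c: "c [^] (a ^ i) = c" for i
    using assms by (induction i) (simp_all add: nat_pow_pow[symmetric])
  show ?thesis using assms c by (induction n) (simp_all add: r_distr nat_pow_distrib)
qed

end

text \<open>The polynomial is \<open>X + X ^ a + \<dots> + X ^ (a ^ n)\<close>.\<close>

lemma (in domain) conjugate_sum_polynomial: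
  assumes "a \<ge> 2"
  shows "\<exists>f\<in>carrier (UP R). deg R f = a ^ n \<and>
    (\<forall>x\<in>carrier R. UnivPoly.eval R R id x f = conjugate_sum R a (Suc n) x)"
proof -
  interpret P: UP_domain R "UP R" by unfold_locales
  show ?thesis
  proof (induction n)
    case 0
    have "UnivPoly.eval R R id x (up_ring.monom (UP R) \<one> 1) = conjugate_sum R a (Suc 0) x"
      if "x \<in> carrier R" for x
      using P.evalRR_monom[OF one_closed that, of 1] that by simp
    moreover have "deg R (up_ring.monom (UP R) \<one> 1) = a ^ 0" by simp
    moreover have "up_ring.monom (UP R) \<one> 1 \<in> carrier (UP R)" by simp
    ultimately show ?case by blast
  next
    case (Suc n)
    then obtain f where f: "f \<in> carrier (UP R)" "deg R f = a ^ n"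
      "\<And>x. x \<in> carrier R \<Longrightarrow> UnivPoly.eval R R id x f = conjugate_sum R a (Suc n) x" by blast
    let ?g = "f \<oplus>\<^bsub>UP R\<^esub> up_ring.monom (UP R) \<one> (a ^ Suc n)"
    have lt: "a ^ n < a ^ Suc n" using assms by simp
    have "deg R ?g = a ^ Suc n"
    proof (rule antisym)
      show "deg R ?g \<le> a ^ Suc n"
        using P.deg_add[OF f(1), of "up_ring.monom (UP R) \<one> (a ^ Suc n)"] lt f(2) by simp
      show "a ^ Suc n \<le> deg R ?g"
        using f(1) P.deg_aboveD[of f "a ^ Suc n"] f(2) lt by (intro P.deg_belowI) auto
    qed
    moreover have "UnivPoly.eval R R id x ?g = conjugate_sum R a (Suc (Suc n)) x" if "x \<in> carrier R" for x
      using that f P.evalRR_add P.evalRR_monom by simp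
    moreover have "?g \<in> carrier (UP R)" using f(1) by simp
    ultimately show ?case by blast
  qed
qed

lemma (in domain) card_conjugate_sum_roots:
  assumes "a \<ge> 2" and "finite (carrier R)"
  shows "card {x \<in> carrier R. conjugate_sum R a (Suc n) x = \<zero>} \<le> a ^ n"
proof -
  interpret P: UP_domain R "UP R" by unfold_locales
  obtain f where f: "f \<in> carrier (UP R)" "deg R f = a ^ n"
      "\<And>x. x \<in> carrier R \<Longrightarrow> UnivPoly.eval R R id x f = conjugate_sum R a (Suc n) x"
    using conjugate_sum_polynomial[OF assms(1)] by blast
  have "f \<noteq> \<zero>\<^bsub>UP R\<^esub>" using f(2) assms(1) P.deg_zero by (metis power_not_zero not_numeral_le_zero)
  then have "card {x \<in> carrier R. UnivPoly.eval R R id x f = \<zero>} \<le> a ^ n"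
    using P.roots_bound[OF f(1) _ assms(2)] f(2) by simp
  moreover have "{x \<in> carrier R. UnivPoly.eval R R id x f = \<zero>} = {x \<in> carrier R. conjugate_sum R a (Suc n) x = \<zero>}"
    using f(3) by auto
  ultimately show ?thesis by simp
qed

section \<open>Characteristic, subfields and Frobenius\<close>

context finite_field
begin

abbreviation char :: nat where "char \<equiv> characteristic R"
abbreviation of_nat_R :: "nat \<Rightarrow> 'a" where "of_nat_R k \<equiv> add_pow R k \<one>"

lemma of_nat_R_eq_zero_iff: "of_nat_R k = \<zero> \<longleftrightarrow> char dvd k"
  using group.pow_eq_id[OF add.is_group, of \<one> k] by (simp add: characteristic_def add_pow_def)

lemma of_nat_R_add: "of_nat_R (k + l) = of_nat_R k \<oplus> of_nat_R l"
  by (simp add: add.nat_pow_mult)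

lemma of_nat_R_mult: "of_nat_R (k * l) = of_nat_R k \<otimes> of_nat_R l"
  by (simp add: add_pow_ldistr add.nat_pow_pow mult.commute)

lemma prime_char: "Factorial_Ring.prime char"
proof -
  have "char \<ge> 1"
    using group.ord_ge_1[OF add.is_group, of \<one>] by (simp add: characteristic_def)
  moreover have "char \<noteq> 1"
    using of_nat_R_eq_zero_iff[of 1] by auto
  ultimately have gt: "char > 1" by simp
  have "a = 1 \<or> a = char" if "a dvd char" for a
  proof -
    obtain b where b: "char = a * b" using \<open>a dvd char\<close> by auto
    then have "of_nat_R a \<otimes> of_nat_R b = \<zero>"
      using of_nat_R_eq_zero_iff[of "a * b"] of_nat_R_mult by simp
    then have "char dvd a \<or> char dvd b"
      using of_nat_R_eq_zero_iff by (auto simp: integral_iff)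
    then show ?thesis
    proof
      assume "char dvd a"
      then show ?thesis using that dvd_antisym by auto
    next
      assume "char dvd b"
      then have "b = char" using b dvd_antisym by (metis dvd_triv_right)
      then show ?thesis using b gt by auto
    qed
  qed
  then show ?thesis using gt by (simp add: prime_nat_iff)
qed

lemma char_gt_1: "char > 1"
  using prime_char prime_gt_1_nat by blast

lemma of_nat_R_mod: "of_nat_R (k mod char) = of_nat_R k"
proof -
  have "of_nat_R k = of_nat_R (char * (k div char)) \<oplus> of_nat_R (k mod char)"
    using of_nat_R_add[of "char * (k div char)" "k mod char"] by simp
  moreover have "of_nat_R (char * (k div char)) = \<zero>"
    using of_nat_R_eq_zero_iff by simp
  ultimately show ?thesis by simp
qed

lemma inj_on_of_nat_R: "inj_on of_nat_R {..<char}"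
proof (rule linorder_inj_onI)
  fix k l :: nat assume *: "k < l" "k \<in> {..<char}" "l \<in> {..<char}"
  show "of_nat_R k \<noteq> of_nat_R l"
  proof
    assume "of_nat_R k = of_nat_R l"
    then have "of_nat_R k \<oplus> \<zero> = of_nat_R k \<oplus> of_nat_R (l - k)"
      using of_nat_R_add[of k "l - k"] * by simp
    then have "of_nat_R (l - k) = \<zero>" by (simp add: add.l_cancel del: r_zero)
    then have "char dvd l - k" using of_nat_R_eq_zero_iff by simp
    then show False using * by (auto dest: dvd_imp_le)
  qed
qed auto

lemma prime_subfield_eq_image: "prime_subfield R = of_nat_R ` {..<char}"
proof -
  have "of_nat_R k \<in> of_nat_R ` {..<char}" for k
    using of_nat_R_mod[of k] char_gt_1 by (intro image_eqI[of _ _ "k mod char"]) auto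
  then show ?thesis unfolding prime_subfield_def by auto
qed

lemma card_prime_subfield: "card (prime_subfield R) = char"
  unfolding prime_subfield_eq_image using card_image[OF inj_on_of_nat_R] by simp

lemma prime_subfield_subset_subfield:
  assumes E: "subfield E R"
  shows "prime_subfield R \<subseteq> E"
proof -
  note E = subringE[OF subfieldE(1)[OF E]]
  have "of_nat_R k \<in> E" for k
    using E by (induction k) auto
  then show ?thesis unfolding prime_subfield_def by auto
qed

text \<open>In a finite field the inverse of \<open>k\<close> is a power of \<open>k\<close>.\<close>

lemma subfieldI_subring:
  assumes E: "subring E R"
  shows "subfield E R"
proof (rule subfieldI'[OF E])
  fix k assume k: "k \<in> E - {\<zero>}"
  then have kn: "k \<in> nonzero" using subringE(1)[OF E] by auto
  have pow: "k [^] (n::nat) \<in> E" for n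
    using k subringE[OF E] by (induction n) auto
  have "k \<otimes> k [^] (units_order - 1) = k [^] Suc (units_order - 1)"
    using kn by (simp add: m_comm)
  also have "\<dots> = \<one>"
  proof -
    have "Suc (units_order - 1) = units_order" using order_gt_1 by simp
    then show ?thesis using nonzero_pow_units_order[OF kn] by (simp only:)
  qed
  finally have "inv k = k [^] (units_order - 1)"
    using kn by (intro comm_inv_char) auto
  then show "inv k \<in> E" using pow by simp
qed

lemma subfield_prime_subfield: "subfield (prime_subfield R) R"
proof (rule subfieldI_subring, rule subringI)
  show "prime_subfield R \<subseteq> carrier R" by (auto simp: prime_subfield_def)
  have one: "\<one> = of_nat_R 1" by simp
  show "\<one> \<in> prime_subfield R" unfolding prime_subfield_def using one by blast
next
  fix h assume "h \<in> prime_subfield R"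
  then obtain k where k: "h = of_nat_R k" by (auto simp: prime_subfield_def)
  have "of_nat_R ((char - 1) * k) \<oplus> of_nat_R k = of_nat_R (char * k)"
    unfolding of_nat_R_add[symmetric] using char_gt_1 by (simp add: algebra_simps)
  also have "\<dots> = \<zero>" using of_nat_R_eq_zero_iff by simp
  finally have "\<ominus> h = of_nat_R ((char - 1) * k)"
    unfolding k by (intro minus_equality) auto
  then show "\<ominus> h \<in> prime_subfield R" by (auto simp: prime_subfield_def)
next
  fix h1 h2 assume "h1 \<in> prime_subfield R" "h2 \<in> prime_subfield R"
  then obtain k l where "h1 = of_nat_R k" "h2 = of_nat_R l" by (auto simp: prime_subfield_def)
  then have "h1 \<otimes> h2 = of_nat_R (k * l)" "h1 \<oplus> h2 = of_nat_R (k + l)"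
    by (simp_all only: of_nat_R_mult of_nat_R_add)
  then show "h1 \<otimes> h2 \<in> prime_subfield R" "h1 \<oplus> h2 \<in> prime_subfield R"
    unfolding prime_subfield_def by (metis rangeI)+
qed

lemma subfield_finite: "subfield E R \<Longrightarrow> finite E"
  using subfieldE(3) finite_subset finite_carrier by blast

lemma card_subfield_eq_char_power:
  assumes "subfield E R"
  shows "card E = char ^ dim (prime_subfield R) E"
  using card_subfield_tower[OF subfield_prime_subfield assms prime_subfield_subset_subfield[OF assms]
      subfield_finite[OF assms]] card_prime_subfield by simp

lemma card_subfield_gt_1:
  assumes "subfield E R"
  shows "card E > 1"
proof -
  have "card {\<zero>, \<one>} \<le> card E"
    using subringE[OF subfieldE(1)[OF assms]] subfield_finite[OF assms] by (intro card_mono) auto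
  then show ?thesis by simp
qed

text \<open>Lagrange's theorem in the subfield gives one inclusion, and the bound on the number of
  roots of \<open>X ^ (card E - 1) - 1\<close> the other.\<close>

lemma nonzero_subfield_eq:
  assumes E: "subfield E R"
  shows "E - {\<zero>} = {x \<in> nonzero. x [^] (card E - 1) = \<one>}"
proof (rule card_subset_eq)
  interpret E: finite_field "R\<lparr>carrier := E\<rparr>"
    using subfield_iff(2)[OF E] subfield_finite[OF E]
    by (auto simp: finite_field_def finite_field_axioms_def)
  show "E - {\<zero>} \<subseteq> {x \<in> nonzero. x [^] (card E - 1) = \<one>}"
    using E.nonzero_pow_units_order subfieldE(3)[OF E]
    by (auto simp: order_def simp flip: nat_pow_consistent)
  then have "card (E - {\<zero>}) \<le> card {x \<in> nonzero. x [^] (card E - 1) = \<one>}"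
    by (intro card_mono) auto
  moreover have "card (E - {\<zero>}) = card E - 1"
    using subringE(2)[OF subfieldE(1)[OF E]] by simp
  moreover have "card {x \<in> nonzero. x [^] (card E - 1) = \<one>} \<le> card E - 1"
    using card_roots_of_unity_le card_subfield_gt_1[OF E] by simp
  ultimately show "card (E - {\<zero>}) = card {x \<in> nonzero. x [^] (card E - 1) = \<one>}" by simp
qed simp

text \<open>Membership in a subfield becomes an equation, which is how traces are seen to lie in the base field.\<close>

lemma subfield_mem_iff:
  assumes E: "subfield E R" and x: "x \<in> carrier R"
  shows "x \<in> E \<longleftrightarrow> x [^] card E = x"
proof (cases "x = \<zero>")
  case True
  then show ?thesis
    using subringE(2)[OF subfieldE(1)[OF E]] card_subfield_gt_1[OF E] by (simp add: nat_pow_zero)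
next
  case False
  have "x [^] card E = x \<otimes> x [^] (card E - 1)"
    using nat_pow_Suc2[OF x, of "card E - 1"] card_subfield_gt_1[OF E] by simp
  moreover have "x \<otimes> x [^] (card E - 1) = x \<otimes> \<one> \<longleftrightarrow> x [^] (card E - 1) = \<one>"
    using x False by (intro m_lcancel) auto
  ultimately show ?thesis
    using nonzero_subfield_eq[OF E] x False by auto
qed

lemma add_pow_char_mult_eq_zero:
  assumes "char dvd k" and "z \<in> carrier R"
  shows "add_pow R k z = \<zero>"
  using add_pow_ldistr[of \<one> z k] of_nat_R_eq_zero_iff[of k] assms by simp

text \<open>All inner binomial coefficients of a prime exponent are divisible by that prime.\<close>

lemma frobenius_add:
  assumes x: "x \<in> carrier R" and y: "y \<in> carrier R"
  shows "(x \<oplus> y) [^] char = x [^] char \<oplus> y [^] char"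
proof -
  \<comment> \<open>The exponent is at least 2, so the first and last terms of the expansion can both be split off.\<close>
  have "char = Suc (Suc (char - 2))" using char_gt_1 by simp
  then obtain n where n: "char = Suc (Suc n)" by blast
  let ?f = "\<lambda>k. add_pow R (char choose k) (x [^] k \<otimes> y [^] (char - k))"
  have f: "?f k \<in> carrier R" for k using x y by simp
  have mid: "?f (Suc k) = \<zero>" if "k \<le> n" for k
    using that x y n by (intro add_pow_char_mult_eq_zero dvd_choose_prime[OF _ _ _ prime_char]) auto
  have "(x \<oplus> y) [^] char = (\<Oplus>k\<in>{..Suc (Suc n)}. ?f k)"
    using binomial_expansion[OF x y, of char] n by simp
  also have "\<dots> = ?f (Suc (Suc n)) \<oplus> ((\<Oplus>k\<in>{..n}. ?f (Suc k)) \<oplus> ?f 0)"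
    using f by (subst finsum_Suc, simp, subst finsum_Suc2) auto
  also have "(\<Oplus>k\<in>{..n}. ?f (Suc k)) = \<zero>"
    using mid by (intro add.finprod_one_eqI) auto
  finally show ?thesis using x y n by simp
qed

lemma frobenius_power_add:
  assumes "x \<in> carrier R" and "y \<in> carrier R"
  shows "(x \<oplus> y) [^] (char ^ k) = x [^] (char ^ k) \<oplus> y [^] (char ^ k)"
proof (induction k)
  case (Suc k)
  have "(x \<oplus> y) [^] (char ^ Suc k) = ((x \<oplus> y) [^] (char ^ k)) [^] char"
    using assms by (simp add: nat_pow_pow mult.commute)
  also have "\<dots> = (x [^] (char ^ k)) [^] char \<oplus> (y [^] (char ^ k)) [^] char"
    using assms by (simp add: Suc.IH frobenius_add)
  finally show ?case using assms by (simp add: nat_pow_pow mult.commute)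
qed (use assms in auto)

section \<open>The trace in a finite field\<close>

lemma conjugate_sum_add:
  assumes "x \<in> carrier R" and "y \<in> carrier R"
  shows "conjugate_sum R (char ^ k) n (x \<oplus> y) =
    conjugate_sum R (char ^ k) n x \<oplus> conjugate_sum R (char ^ k) n y"
  using assms
  by (induction n) (simp_all add: power_mult[symmetric] frobenius_power_add a_ac)

text \<open>Transitivity of the trace: the exponents \<open>char ^ k\<close> with \<open>k < n * m\<close> are split into \<open>m\<close> blocks of
  length \<open>n\<close>, and additivity collects the blocks.\<close>

lemma conjugate_sum_trans:
  assumes "x \<in> carrier R"
  shows "conjugate_sum R char (n * m) x = conjugate_sum R char n (conjugate_sum R (char ^ n) m x)"
proof (induction m)
  case 0
  show ?case using conjugate_sum_add[of \<zero> \<zero> 1 n] by (simp add: add.l_cancel_one')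
next
  case (Suc m)
  have "conjugate_sum R char (n * Suc m) x = conjugate_sum R char (n * m + n) x"
    by (simp add: add.commute)
  also have "\<dots> = conjugate_sum R char (n * m) x \<oplus> conjugate_sum R char n (x [^] (char ^ (n * m)))"
    by (rule conjugate_sum_add_index[OF assms])
  finally show ?case
    using assms conjugate_sum_add[of _ _ 1 n] by (simp add: Suc.IH power_mult)
qed

text \<open>Raising to the power \<open>char ^ k\<close> permutes the conjugates cyclically.\<close>

lemma conjugate_sum_power:
  assumes x: "x \<in> carrier R" and "x [^] ((char ^ k) ^ n) = x"
  shows "conjugate_sum R (char ^ k) n x [^] (char ^ k) = conjugate_sum R (char ^ k) n x"
proof -
  let ?q = "char ^ k"
  \<comment> \<open>The end terms stay on opposite sides, since for smaller \<open>n\<close> they need not be equal.\<close>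
  have "conjugate_sum R ?q n x [^] ?q \<oplus> x = conjugate_sum R ?q n x \<oplus> x [^] (?q ^ n)"
  proof (induction n)
    case 0
    then show ?case using x char_gt_1 by (simp add: nat_pow_zero)
  next
    case (Suc n)
    have "conjugate_sum R ?q (Suc n) x [^] ?q \<oplus> x =
        (conjugate_sum R ?q n x [^] ?q \<oplus> x) \<oplus> x [^] (?q ^ Suc n)"
      using x by (simp add: frobenius_power_add nat_pow_pow a_ac mult.commute)
    then show ?case using x Suc.IH by simp
  qed
  then show ?thesis using assms by (simp add: add.r_cancel)
qed

lemma field_trace_in_subfield:
  assumes F: "subfield F R" and E: "subfield E R" and "F \<subseteq> E" and x: "x \<in> E"
  shows "field_trace R E F x \<in> F"
proof -
  have xc: "x \<in> carrier R" using subfieldE(3)[OF E] x by auto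
  have "x [^] card F ^ dim F E = x"
    using card_subfield_tower[OF F E \<open>F \<subseteq> E\<close> subfield_finite[OF E]] subfield_mem_iff[OF E xc] x by simp
  then have "field_trace R E F x [^] card F = field_trace R E F x"
    using conjugate_sum_power[OF xc] card_subfield_eq_char_power[OF F]
    by (simp add: field_trace_eq_conjugate_sum)
  then show ?thesis
    using subfield_mem_iff[OF F] xc by (simp add: field_trace_eq_conjugate_sum)
qed

lemma field_trace_add:
  assumes F: "subfield F R" and "x \<in> carrier R" and "y \<in> carrier R"
  shows "field_trace R E F (x \<oplus> y) = field_trace R E F x \<oplus> field_trace R E F y"
  using conjugate_sum_add[OF assms(2,3)] card_subfield_eq_char_power[OF F]
  by (simp add: field_trace_eq_conjugate_sum)

lemma field_trace_smult:
  assumes F: "subfield F R" and "x \<in> carrier R" and "a \<in> F"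
  shows "field_trace R E F (a \<otimes> x) = a \<otimes> field_trace R E F x"
proof -
  have "a \<in> carrier R" using subfieldE(3)[OF F] \<open>a \<in> F\<close> by (rule subsetD)
  then show ?thesis
    using conjugate_sum_smult[of x a "card F"] assms subfield_mem_iff[OF F]
    by (simp add: field_trace_eq_conjugate_sum)
qed

lemma field_trace_trans:
  assumes F: "subfield F R" and E: "subfield E R" and "F \<subseteq> E" and x: "x \<in> carrier R"
  shows "field_trace R E (prime_subfield R) x =
    field_trace R F (prime_subfield R) (field_trace R E F x)"
proof -
  let ?P = "prime_subfield R"
  have "char ^ dim ?P E = (char ^ dim ?P F) ^ dim F E"
    using card_subfield_tower[OF F E \<open>F \<subseteq> E\<close> subfield_finite[OF E]]
      card_subfield_eq_char_power[OF F] card_subfield_eq_char_power[OF E] by simp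
  then have "dim ?P E = dim ?P F * dim F E"
    using char_gt_1 by (simp add: power_mult[symmetric] power_inject_exp)
  then show ?thesis
    using conjugate_sum_trans[OF x] card_prime_subfield card_subfield_eq_char_power[OF F]
    by (simp add: field_trace_eq_conjugate_sum)
qed

text \<open>The trace is a polynomial of degree \<open>card E / char\<close>, so it cannot vanish on all of \<open>E\<close>.\<close>

lemma exists_field_trace_nonzero:
  assumes E: "subfield E R"
  shows "\<exists>x\<in>E. field_trace R E (prime_subfield R) x \<noteq> \<zero>"
proof (rule ccontr)
  let ?n = "dim (prime_subfield R) E"
  assume "\<not> ?thesis"
  moreover have card: "card E = char ^ ?n" by (rule card_subfield_eq_char_power[OF E])
  then obtain k where k: "?n = Suc k"
    using card_subfield_gt_1[OF E] by (cases ?n) auto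
  ultimately have "E \<subseteq> {x \<in> carrier R. conjugate_sum R char (Suc k) x = \<zero>}"
    using subfieldE(3)[OF E] card_prime_subfield
    by (auto simp: field_trace_eq_conjugate_sum simp del: conjugate_sum_Suc)
  then have "card E \<le> card {x \<in> carrier R. conjugate_sum R char (Suc k) x = \<zero>}"
    by (intro card_mono) auto
  also have "\<dots> \<le> char ^ k"
    using card_conjugate_sum_roots char_gt_1 by simp
  finally show False using card k char_gt_1 by simp
qed

end

section \<open>Additive characters\<close>

context finite_field
begin

lemma prime_subfield_rep_of_nat_R: "prime_subfield_rep R (of_nat_R k) = k mod char"
  unfolding prime_subfield_rep_def
proof (rule the_equality)
  show "k mod char < char \<and> of_nat_R (k mod char) = of_nat_R k"
    using char_gt_1 of_nat_R_mod by simp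
  show "l = k mod char" if "l < char \<and> of_nat_R l = of_nat_R k" for l
    using that inj_onD[OF inj_on_of_nat_R, of l "k mod char"] of_nat_R_mod[of k] char_gt_1 by simp
qed

text \<open>The canonical character of the prime field, through which all others factor by the trace.\<close>

definition prime_character :: "'a \<Rightarrow> complex" where
  "prime_character y = exp (2 * of_real pi * \<i> * of_nat (prime_subfield_rep R y) / of_nat char)"

lemma add_character_eq_prime_character:
  "add_character R E x = prime_character (field_trace R E (prime_subfield R) x)"
  by (simp add: add_character_def prime_character_def)

text \<open>By periodicity of \<open>cis\<close> any representative \<open>k\<close> gives the same value, so the character is multiplicative
  by the addition formula for \<open>cis\<close>.\<close>

lemma prime_character_of_nat_R:
  "prime_character (of_nat_R k) = cis (2 * pi * real k / real char)"
proof -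
  let ?z = "\<lambda>k. cis (2 * pi * real k / real char)"
  have "?z k = ?z (char * (k div char)) * ?z (k mod char)"
    unfolding cis_mult add_divide_distrib[symmetric] distrib_left[symmetric] of_nat_add[symmetric]
    by simp
  also have "?z (char * (k div char)) = 1"
    using char_gt_1 cis_multiple_2pi[of "real (k div char)"] by (simp add: mult_ac)
  finally have "?z k = ?z (k mod char)" by simp
  then show ?thesis
    by (simp add: prime_character_def prime_subfield_rep_of_nat_R cis_conv_exp mult_ac)
qed

lemma prime_character_add:
  assumes "y \<in> prime_subfield R" and "z \<in> prime_subfield R"
  shows "prime_character (y \<oplus> z) = prime_character y * prime_character z"
proof -
  obtain k l where kl: "y = of_nat_R k" "z = of_nat_R l"
    using assms by (auto simp: prime_subfield_def)
  then have "y \<oplus> z = of_nat_R (k + l)" by (simp only: of_nat_R_add)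
  then show ?thesis
    unfolding kl by (simp only: prime_character_of_nat_R cis_mult)
      (simp add: distrib_left add_divide_distrib)
qed

lemma prime_character_eq_1_iff:
  assumes "y \<in> prime_subfield R"
  shows "prime_character y = 1 \<longleftrightarrow> y = \<zero>"
proof -
  obtain k where k: "y = of_nat_R k" "k < char"
    using assms by (auto simp: prime_subfield_eq_image)
  have "inj_on (\<lambda>k. cis (2 * pi * real k / real char)) {..<char}"
    using bij_betw_roots_unity[of char] char_gt_1 by (simp add: bij_betw_def)
  from inj_onD[OF this, of k 0] have "prime_character y = 1 \<longleftrightarrow> k = 0"
    unfolding k prime_character_of_nat_R using k(2) by auto
  also have "\<dots> \<longleftrightarrow> y = \<zero>"
    using of_nat_R_eq_zero_iff[of k] k by (auto dest: dvd_imp_le)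
  finally show ?thesis .
qed

lemma field_trace_in_prime_subfield:
  "subfield E R \<Longrightarrow> x \<in> E \<Longrightarrow> field_trace R E (prime_subfield R) x \<in> prime_subfield R"
  using field_trace_in_subfield[OF subfield_prime_subfield] prime_subfield_subset_subfield by blast

lemma add_character_add:
  assumes E: "subfield E R" and x: "x \<in> E" and y: "y \<in> E"
  shows "add_character R E (x \<oplus> y) = add_character R E x * add_character R E y"
proof -
  have "x \<in> carrier R" "y \<in> carrier R" using subfieldE(3)[OF E] x y by auto
  then show ?thesis
    by (simp add: add_character_eq_prime_character field_trace_add[OF subfield_prime_subfield]
        prime_character_add field_trace_in_prime_subfield[OF E] x y)
qed

lemma add_character_zero:
  assumes E: "subfield E R"
  shows "add_character R E \<zero> = 1"
proof -
  have z: "\<zero> \<in> E" using subringE(2)[OF subfieldE(1)[OF E]] .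
  have "add_character R E \<zero> = add_character R E \<zero> * add_character R E \<zero>"
    using add_character_add[OF E z z] by simp
  moreover have "add_character R E \<zero> \<noteq> 0" by (simp add: add_character_def)
  ultimately show ?thesis by simp
qed

lemma cnj_add_character:
  assumes E: "subfield E R" and x: "x \<in> E"
  shows "cnj (add_character R E x) = add_character R E (\<ominus> x)"
proof -
  have xc: "x \<in> carrier R" and mx: "\<ominus> x \<in> E"
    using subfieldE(3)[OF E] subringE(5)[OF subfieldE(1)[OF E]] x by auto
  have "norm (add_character R E x) = 1"
    by (simp add: add_character_def)
  then have "cnj (add_character R E x) * add_character R E x = 1"
    using complex_norm_square[of "add_character R E x"] by (simp add: mult.commute)
  moreover have "add_character R E (\<ominus> x) * add_character R E x = 1"
    using add_character_add[OF E mx x] add_character_zero[OF E] xc by (simp add: l_neg)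
  moreover have "add_character R E x \<noteq> 0" by (simp add: add_character_def)
  ultimately show ?thesis by (metis mult_right_cancel)
qed

text \<open>Transitivity and linearity of the trace turn a character of the large field, twisted by a scalar of the
  small one, into a character of the small field evaluated at the trace.\<close>

lemma add_character_trans:
  assumes F: "subfield F R" and E: "subfield E R" and "F \<subseteq> E" and "x \<in> E" and "a \<in> F"
  shows "add_character R E (a \<otimes> x) = add_character R F (a \<otimes> field_trace R E F x)"
proof -
  have x: "x \<in> carrier R" and a: "a \<in> carrier R"
    using subfieldE(3)[OF E] \<open>x \<in> E\<close> \<open>a \<in> F\<close> \<open>F \<subseteq> E\<close> by auto
  show ?thesis
    using field_trace_trans[OF F E \<open>F \<subseteq> E\<close>, of "a \<otimes> x"] x a field_trace_smult[OF F x \<open>a \<in> F\<close>]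
    by (simp add: add_character_eq_prime_character)
qed

text \<open>Orthogonality.  If \<open>b \<noteq> 0\<close>, then \<open>a \<mapsto> a * b\<close> runs through all of \<open>F\<close>, so some \<open>c\<close> has
  \<open>\<chi>(c * b) \<noteq> 1\<close>; translating the summation variable by \<open>c\<close> multiplies the sum by this value.\<close>

lemma sum_add_character_mult:
  assumes F: "subfield F R" and b: "b \<in> F"
  shows "(\<Sum>a\<in>F. add_character R F (a \<otimes> b)) = (if b = \<zero> then of_nat (card F) else 0)"
proof (cases "b = \<zero>")
  case True
  then have "(\<Sum>a\<in>F. add_character R F (a \<otimes> b)) = (\<Sum>a\<in>F. 1)"
    using subfieldE(3)[OF F] add_character_zero[OF F] by (intro sum.cong) auto
  then show ?thesis using True by simp
next
  case False
  note sub = subringE[OF subfieldE(1)[OF F]]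
  have carr: "a \<in> carrier R" if "a \<in> F" for a using that sub(1) by auto
  let ?S = "\<Sum>a\<in>F. add_character R F (a \<otimes> b)"
  obtain x where x: "x \<in> F" "field_trace R F (prime_subfield R) x \<noteq> \<zero>"
    using exists_field_trace_nonzero[OF F] by blast
  have ib: "inv b \<in> F" "inv b \<otimes> b = \<one>" using subfield_m_inv[OF F, of b] b False by auto
  \<comment> \<open>This choice makes \<open>c * b\<close> an element of nonzero trace, where the character is not 1.\<close>
  define c where "c = x \<otimes> inv b"
  have c: "c \<in> F" "c \<otimes> b = x"
    using x(1) ib b carr sub(6) by (auto simp: c_def m_assoc)
  have cb: "add_character R F (c \<otimes> b) \<noteq> 1"
    using prime_character_eq_1_iff[OF field_trace_in_prime_subfield[OF F x(1)]] x(2)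
    unfolding c(2) add_character_eq_prime_character by simp
  have inj: "inj_on (\<lambda>a. c \<oplus> a) F"
    using c(1) carr by (auto simp: inj_on_def)
  moreover have "(\<lambda>a. c \<oplus> a) ` F = F"
    using inj sub(7) c(1) by (intro endo_inj_surj[OF subfield_finite[OF F]]) auto
  ultimately have "?S = (\<Sum>a\<in>F. add_character R F ((c \<oplus> a) \<otimes> b))"
    using sum.reindex[OF inj, of "\<lambda>a. add_character R F (a \<otimes> b)"] by simp
  also have "\<dots> = (\<Sum>a\<in>F. add_character R F (c \<otimes> b) * add_character R F (a \<otimes> b))"
    using c(1) b carr sub(6) by (intro sum.cong) (auto simp: l_distr add_character_add[OF F])
  also have "\<dots> = add_character R F (c \<otimes> b) * ?S" by (simp add: sum_distrib_left)
  finally have "?S = 0" using cb by (metis mult_cancel_right2)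
  then show ?thesis using False by simp
qed

text \<open>With \<open>t\<close> the trace of \<open>x\<close>, the summand is the character of \<open>F\<close> at \<open>a * (t - c)\<close>, so orthogonality
  detects whether \<open>t = c\<close>.\<close>

lemma sum_character_trace_indicator:
  assumes F: "subfield F R" and E: "subfield E R" and FE: "F \<subseteq> E" and x: "x \<in> E" and c: "c \<in> F"
  shows "(\<Sum>a\<in>F. cnj (add_character R F (a \<otimes> c)) * add_character R E (a \<otimes> x)) =
    (if field_trace R E F x = c then of_nat (card F) else 0)"
proof -
  let ?t = "field_trace R E F x"
  note sub = subringE[OF subfieldE(1)[OF F]]
  have carr: "a \<in> carrier R" if "a \<in> F" for a using that sub(1) by auto
  have t: "?t \<in> F" by (rule field_trace_in_subfield[OF F E FE x])
  have "cnj (add_character R F (a \<otimes> c)) * add_character R E (a \<otimes> x) =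
      add_character R F (a \<otimes> (?t \<ominus> c))" if a: "a \<in> F" for a
  proof -
    have "cnj (add_character R F (a \<otimes> c)) * add_character R E (a \<otimes> x) =
        add_character R F (\<ominus> (a \<otimes> c) \<oplus> a \<otimes> ?t)"
      using a c t sub(5,6) cnj_add_character[OF F, of "a \<otimes> c"] add_character_trans[OF F E FE x a]
      by (simp add: add_character_add[OF F])
    also have "\<ominus> (a \<otimes> c) \<oplus> a \<otimes> ?t = a \<otimes> (?t \<ominus> c)"
      using a c t carr by (simp add: a_minus_def r_distr r_minus a_comm)
    finally show ?thesis .
  qed
  moreover have "?t \<ominus> c \<in> F" using t c sub(5,7) by (simp add: a_minus_def)
  moreover have "?t \<ominus> c = \<zero> \<longleftrightarrow> ?t = c" using t c carr by simp
  ultimately show ?thesis using sum_add_character_mult[OF F, of "?t \<ominus> c"] by simp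
qed

section \<open>Gaussian periods and elements of given trace\<close>

text \<open>Since \<open>\<alpha>\<close> generates the multiplicative group, \<open>\<langle>\<alpha> ^ e\<rangle>\<close> is the image of \<open>x \<mapsto> x ^ e\<close>.  This is what
  makes Gaussian periods appear in the counting formula.\<close>

lemma generate_pow_primitive:
  assumes a: "primitive_element R \<alpha>" and e: "e dvd units_order"
  shows "generate (mult_group R) {\<alpha> [^]\<^bsub>mult_group R\<^esub> e} =
    {y \<in> nonzero. y [^] (units_order div e) = \<one>}"
proof -
  interpret G: group "mult_group R" by (rule mult_group_is_group)
  have \<alpha>: "\<alpha> \<in> carrier (mult_group R)" "generate (mult_group R) {\<alpha>} = carrier (mult_group R)"
    using a by (auto simp: primitive_element_def)
  have fin: "finite (carrier (mult_group R))" by simp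
  have gen: "nonzero = {\<alpha> [^] k | k::nat. True}"
    using G.generate_pow_on_finite_carrier[OF fin \<alpha>(1)] \<alpha>(2)
    by (simp add: Multiplicative_Group.nat_pow_mult_of)
  have "generate (mult_group R) {\<alpha> [^]\<^bsub>mult_group R\<^esub> e} = {(\<alpha> [^] e) [^] k | k::nat. True}"
    using G.generate_pow_on_finite_carrier[OF fin, of "\<alpha> [^]\<^bsub>mult_group R\<^esub> e"] \<alpha>(1)
      nonzero_nat_pow[of \<alpha> e]
    by (simp add: Multiplicative_Group.nat_pow_mult_of)
  also have "\<dots> = (\<lambda>x. x [^] e) ` {\<alpha> [^] k | k::nat. True}"
  proof -
    have "(\<alpha> [^] e) [^] k = (\<alpha> [^] k) [^] e" for k :: nat
      using \<alpha>(1) by (simp add: nat_pow_pow mult.commute)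
    then show ?thesis by (simp only:) blast
  qed
  also have "\<dots> = {y \<in> nonzero. y [^] (units_order div e) = \<one>}"
    unfolding gen[symmetric] by (rule power_map_fibers(1)[OF e])
  finally show ?thesis .
qed

lemma gaussian_period_eq:
  assumes a: "primitive_element R \<alpha>" and e: "e dvd units_order"
  shows "gaussian_period R \<alpha> e (int k) =
    (\<Sum>y | y \<in> nonzero \<and> y [^] (units_order div e) = \<one>. add_character R (carrier R) (\<alpha> [^] k \<otimes> y))"
proof -
  have \<alpha>: "\<alpha> [^] k \<in> nonzero"
    using a nonzero_nat_pow by (auto simp: primitive_element_def)
  have "gaussian_period R \<alpha> e (int k) = (\<Sum>x\<in>(\<lambda>y. \<alpha> [^] k \<otimes> y) `
      {y \<in> nonzero. y [^] (units_order div e) = \<one>}. add_character R (carrier R) x)"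
    unfolding gaussian_period_def generate_pow_primitive[OF a e] int_pow_int
    by (rule sum.cong) (auto simp: l_coset_def Multiplicative_Group.nat_pow_mult_of)
  also have "\<dots> = (\<Sum>y | y \<in> nonzero \<and> y [^] (units_order div e) = \<one>. add_character R (carrier R) (\<alpha> [^] k \<otimes> y))"
    using \<alpha> by (subst sum.reindex) (auto simp: inj_on_def m_lcancel)
  finally show ?thesis .
qed

text \<open>The nonzero elements of \<open>K\<close> are the \<open>(card K - 1)\<close>-th roots of unity, and the distinct powers
  \<open>\<alpha> ^ (Q * i)\<close> already supply that many of them.\<close>

lemma subfield_units_primitive:
  assumes a: "primitive_element R \<alpha>" and K: "subfield K R"
    and Q: "units_order = Q * (card K - 1)"
  shows "bij_betw (\<lambda>i. \<alpha> [^] (Q * i)) {..<card K - 1} (K - {\<zero>})"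
proof -
  interpret G: group "mult_group R" by (rule mult_group_is_group)
  have \<alpha>: "\<alpha> \<in> carrier (mult_group R)" "generate (mult_group R) {\<alpha>} = carrier (mult_group R)"
    using a by (auto simp: primitive_element_def)
  have ord: "G.ord \<alpha> = units_order"
    using G.generate_pow_card[OF \<alpha>(1)] \<alpha>(2) card_nonzero by simp
  have Qpos: "Q > 0" using Q order_gt_1 by (auto intro!: Nat.gr0I)
  have inj: "inj_on (\<lambda>i. \<alpha> [^] (Q * i)) {..<card K - 1}"
  proof (rule inj_onI)
    fix i j assume ij: "i \<in> {..<card K - 1}" "j \<in> {..<card K - 1}" "\<alpha> [^] (Q * i) = \<alpha> [^] (Q * j)"
    have "Q * i < units_order" "Q * j < units_order"
      unfolding Q using ij(1,2) Qpos by auto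
    then have lt: "Q * i \<le> units_order - 1" "Q * j \<le> units_order - 1" by auto
    have "Q * i = Q * j"
      using inj_onD[OF G.ord_inj[OF \<alpha>(1)], of "Q * i" "Q * j"] ij(3) lt
      by (simp add: ord Multiplicative_Group.nat_pow_mult_of)
    then show "i = j" using Qpos by simp
  qed
  moreover have "(\<lambda>i. \<alpha> [^] (Q * i)) ` {..<card K - 1} = K - {\<zero>}"
  proof (rule card_subset_eq)
    show "finite (K - {\<zero>})" using subfield_finite[OF K] by simp
    show "(\<lambda>i. \<alpha> [^] (Q * i)) ` {..<card K - 1} \<subseteq> K - {\<zero>}"
    proof
      fix y assume "y \<in> (\<lambda>i. \<alpha> [^] (Q * i)) ` {..<card K - 1}"
      then obtain i where y: "y = \<alpha> [^] (Q * i)" by auto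
      have "y [^] (card K - 1) = (\<alpha> [^] units_order) [^] i"
        using \<alpha>(1) unfolding y Q by (simp add: nat_pow_pow mult_ac)
      then have "y [^] (card K - 1) = \<one>" using nonzero_pow_units_order \<alpha>(1) by simp
      then show "y \<in> K - {\<zero>}"
        using nonzero_subfield_eq[OF K] nonzero_nat_pow[of \<alpha> "Q * i"] \<alpha>(1) y by simp
    qed
    show "card ((\<lambda>i. \<alpha> [^] (Q * i)) ` {..<card K - 1}) = card (K - {\<zero>})"
      using card_image[OF inj] subringE(2)[OF subfieldE(1)[OF K]] by simp
  qed
  ultimately show ?thesis by (simp add: bij_betw_def)
qed

lemma card_elements_of_order_with_trace:
  assumes K: "subfield K R" and c: "c \<in> K" and N: "N > 0" "N dvd units_order"
  shows "(of_nat (card {\<beta> \<in> nonzero. group.ord (mult_group R) \<beta> = N \<and>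
        field_trace R (carrier R) K \<beta> = c}) :: complex) =
    of_nat N / (of_nat (card K) * of_nat units_order) *
      (\<Sum>d | d dvd N. of_int (moebius_mu d) / of_nat d *
        (\<Sum>a\<in>K. cnj (add_character R K (a \<otimes> c)) *
          (\<Sum>x\<in>nonzero. add_character R (carrier R) (a \<otimes> x [^] (units_order div N * d)))))"
proof -
  let ?S = "{x \<in> nonzero. group.ord (mult_group R) x = N}"
  let ?f = "\<lambda>x. \<Sum>a\<in>K. cnj (add_character R K (a \<otimes> c)) * add_character R (carrier R) (a \<otimes> x)"
  have q: "of_nat (card K) \<noteq> (0 :: complex)" using card_subfield_gt_1[OF K] by simp
  have "(\<Sum>x\<in>?S. ?f x) = (\<Sum>x\<in>?S. if field_trace R (carrier R) K x = c then of_nat (card K) else 0)"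
    using sum_character_trace_indicator[OF K carrier_is_subfield subfieldE(3)[OF K] _ c]
    by (intro sum.cong) auto
  also have "\<dots> = of_nat (card K) * of_nat (card {x \<in> ?S. field_trace R (carrier R) K x = c})"
    by (subst sum.inter_filter[symmetric]) auto
  finally have "of_nat (card {x \<in> ?S. field_trace R (carrier R) K x = c}) = (\<Sum>x\<in>?S. ?f x) / of_nat (card K)"
    using q by simp
  also have "(\<Sum>x\<in>?S. ?f x) = of_nat N / of_nat units_order *
      (\<Sum>d | d dvd N. of_int (moebius_mu d) / of_nat d * (\<Sum>x\<in>nonzero. ?f (x [^] (units_order div N * d))))"
    by (rule sum_over_elements_of_order[OF N])
  also have "(\<lambda>d. \<Sum>x\<in>nonzero. ?f (x [^] (units_order div N * d))) =
      (\<lambda>d. \<Sum>a\<in>K. cnj (add_character R K (a \<otimes> c)) *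
          (\<Sum>x\<in>nonzero. add_character R (carrier R) (a \<otimes> x [^] (units_order div N * d))))"
    unfolding sum_distrib_left by (rule ext, rule sum.swap)
  also have "{x \<in> ?S. field_trace R (carrier R) K x = c} =
    {\<beta> \<in> nonzero. group.ord (mult_group R) \<beta> = N \<and> field_trace R (carrier R) K \<beta> = c}" by auto
  finally show ?thesis by (simp add: mult.commute)
qed

text \<open>The term \<open>a = 0\<close> contributes \<open>\<phi>(N)\<close>.  For \<open>a = \<alpha> ^ (Q * i)\<close> the power map with exponent
  \<open>e = M / N * d\<close>, where \<open>M\<close> is the order of the multiplicative group, covers \<open>\<langle>\<alpha> ^ e\<rangle>\<close> exactly \<open>e\<close>
  times, so the sum over \<open>x\<close> is \<open>e\<close> times a Gaussian period, and \<open>e\<close> cancels the prefactor \<open>N / (M * d)\<close>.\<close>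

lemma trace_sum_eq_gaussian_periods:
  assumes a: "primitive_element R \<alpha>" and K: "subfield K R" and c: "c \<in> K"
    and N: "N > 0" "N dvd units_order" and Q: "units_order = Q * (card K - 1)"
  shows "of_nat N / (of_nat (card K) * of_nat units_order) *
      (\<Sum>d | d dvd N. of_int (moebius_mu d) / of_nat d *
        (\<Sum>a\<in>K. cnj (add_character R K (a \<otimes> c)) *
          (\<Sum>x\<in>nonzero. add_character R (carrier R) (a \<otimes> x [^] (units_order div N * d))))) =
    1 / of_nat (card K) * (of_nat (totient N) +
      (\<Sum>i<card K - 1. cnj (add_character R K (\<alpha> [^] (Q * i) \<otimes> c)) *
        (\<Sum>d | d dvd N. of_int (moebius_mu d) *
          gaussian_period R \<alpha> (units_order div N * d) (int (Q * i)))))"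
    (is "_ * ?D = _")
proof -
  let ?M = units_order
  let ?w = "\<lambda>a. cnj (add_character R K (a \<otimes> c))"
  let ?e = "\<lambda>d. ?M div N * d"
  let ?X = "\<lambda>d a. \<Sum>x\<in>nonzero. add_character R (carrier R) (a \<otimes> x [^] ?e d)"
  have Mpos: "?M > 0" using order_gt_1 by simp
  have carr: "a \<in> carrier R" if "a \<in> K" for a using that subfieldE(3)[OF K] by auto
  have zK: "\<zero> \<in> K" using subringE(2)[OF subfieldE(1)[OF K]] .
  have swap: "?D = (\<Sum>a\<in>K. ?w a * (\<Sum>d | d dvd N. of_int (moebius_mu d) / of_nat d * ?X d a))"
    unfolding sum_distrib_left by (subst sum.swap) (simp add: mult_ac)
  have zero: "of_nat N / of_nat ?M * (?w \<zero> * (\<Sum>d | d dvd N. of_int (moebius_mu d) / of_nat d * ?X d \<zero>)) =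
      of_nat (totient N)"
  proof -
    have "?w \<zero> = 1" using c carr add_character_zero[OF K] by simp
    moreover have "?X d \<zero> = of_nat ?M" for d
    proof -
      have "?X d \<zero> = (\<Sum>x\<in>nonzero. 1)"
        by (intro sum.cong) (auto simp: add_character_zero[OF carrier_is_subfield])
      then show ?thesis using card_nonzero by simp
    qed
    ultimately show ?thesis
      unfolding totient_eq_moebius_sum[OF N] using Mpos
      by (simp only: sum_distrib_right[symmetric]) simp
  qed
  have period: "of_nat N / of_nat ?M * (of_int (moebius_mu d) / of_nat d * ?X d (\<alpha> [^] (Q * i))) =
      of_int (moebius_mu d) * gaussian_period R \<alpha> (?e d) (int (Q * i))" if dN: "d dvd N" for d i
  proof -
    have d: "d > 0" using dN N by (auto intro!: Nat.gr0I)
    obtain k where k: "?M = N * k" using N by auto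
    obtain j where j: "N = d * j" using dN by auto
    have ek: "?e d = k * d" using k N by simp
    have "?M = ?e d * j" unfolding ek using k j by simp
    then have e: "?e d dvd ?M" by (metis dvd_triv_left)
    have "k > 0" using k Mpos by (auto intro!: Nat.gr0I)
    have "?X d (\<alpha> [^] (Q * i)) = of_nat (?e d) * gaussian_period R \<alpha> (?e d) (int (Q * i))"
      unfolding gaussian_period_eq[OF a e]
      by (rule sum_power_map[OF e, of "\<lambda>y. add_character R (carrier R) (\<alpha> [^] (Q * i) \<otimes> y)"])
    then show ?thesis
      unfolding ek k using d N \<open>k > 0\<close> by (simp add: field_simps)
  qed
  have bij: "bij_betw (\<lambda>i. \<alpha> [^] (Q * i)) {..<card K - 1} (K - {\<zero>})"
    by (rule subfield_units_primitive[OF a K Q])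
  let ?B = "\<lambda>a. of_nat N / of_nat ?M * (?w a * (\<Sum>d | d dvd N. of_int (moebius_mu d) / of_nat d * ?X d a))"
  have "of_nat N / of_nat ?M * ?D = (\<Sum>a\<in>K. ?B a)"
    unfolding swap by (simp only: sum_distrib_left)
  also have "\<dots> = ?B \<zero> + (\<Sum>a\<in>K - {\<zero>}. ?B a)"
    by (rule sum.remove[OF subfield_finite[OF K] zK])
  also have "(\<Sum>a\<in>K - {\<zero>}. ?B a) = (\<Sum>i<card K - 1. ?B (\<alpha> [^] (Q * i)))"
    by (rule sum.reindex_bij_betw[OF bij, symmetric])
  also have "\<dots> = (\<Sum>i<card K - 1. ?w (\<alpha> [^] (Q * i)) *
        (\<Sum>d | d dvd N. of_int (moebius_mu d) * gaussian_period R \<alpha> (?e d) (int (Q * i))))"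
  proof (rule sum.cong)
    fix i
    have "?B (\<alpha> [^] (Q * i)) = ?w (\<alpha> [^] (Q * i)) *
      (\<Sum>d | d dvd N. of_nat N / of_nat ?M * (of_int (moebius_mu d) / of_nat d * ?X d (\<alpha> [^] (Q * i))))"
      unfolding sum_distrib_left[symmetric] by (simp only: mult_ac)
    also have "(\<Sum>d | d dvd N. of_nat N / of_nat ?M * (of_int (moebius_mu d) / of_nat d * ?X d (\<alpha> [^] (Q * i)))) =
      (\<Sum>d | d dvd N. of_int (moebius_mu d) * gaussian_period R \<alpha> (?e d) (int (Q * i)))"
      by (rule sum.cong[OF refl], rule period) simp
    finally show "?B (\<alpha> [^] (Q * i)) = ?w (\<alpha> [^] (Q * i)) *
      (\<Sum>d | d dvd N. of_int (moebius_mu d) * gaussian_period R \<alpha> (?e d) (int (Q * i)))" .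
  qed simp
  also note zero
  finally have *: "of_nat N / of_nat ?M * ?D = of_nat (totient N) + (\<Sum>i<card K - 1. ?w (\<alpha> [^] (Q * i)) *
        (\<Sum>d | d dvd N. of_int (moebius_mu d) * gaussian_period R \<alpha> (?e d) (int (Q * i))))" .
  have "of_nat N / (of_nat (card K) * of_nat ?M) * ?D = 1 / of_nat (card K) * (of_nat N / of_nat ?M * ?D)"
    by simp
  then show ?thesis unfolding * .
qed

end

section \<open>The counting formulas\<close>

lemma pred_dvd_power_pred: "q - 1 dvd q ^ m - (1::nat)"
proof (cases q)
  case (Suc r)
  show ?thesis unfolding Suc
  proof (induction m)
    case (Suc m)
    obtain k where "Suc r ^ m = Suc k" by (cases "Suc r ^ m") auto
    then have "Suc r ^ Suc m - 1 = Suc r * (Suc r ^ m - 1) + (Suc r - 1)" by simp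
    then show ?case using Suc.IH by (simp only: dvd_add dvd_mult dvd_refl)
  qed simp
qed (cases m; simp)

theorem lemma6p1:
  fixes L :: "('a, 'b) ring_scheme" and K :: "'a set" and \<alpha> :: 'a and q m N Q :: nat
  assumes "primepow q" and "m > 0"
    and "field L" and "order L = q ^ m"
    and "subfield K L" and "card K = q"
    and "Q = (q ^ m - 1) div (q - 1)"
    and "primitive_element L \<alpha>"
    and "N > 0" and "N dvd q ^ m - 1"
  shows
    "(\<forall>A. A \<subseteq> carrier L \<longrightarrow>
        real (card {x \<in> A. x \<noteq> \<zero>\<^bsub>L\<^esub> \<and> group.ord (mult_group L) x = N}) =
          1 / (real q ^ m - 1) *
            (\<Sum>d | d dvd N. of_int (moebius_mu d) * (real N / real d) *
               real (card {x \<in> carrier L - {\<zero>\<^bsub>L\<^esub>}. x [^]\<^bsub>L\<^esub> ((q ^ m - 1) div N * d) \<in> A})))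
     \<and>
     (\<forall>c\<in>K.
        (of_nat (card {\<beta> \<in> carrier L - {\<zero>\<^bsub>L\<^esub>}.
                         group.ord (mult_group L) \<beta> = N \<and> field_trace L (carrier L) K \<beta> = c}) :: complex) =
          of_nat N / (of_nat q * (of_nat q ^ m - 1)) *
            (\<Sum>d | d dvd N. of_int (moebius_mu d) / of_nat d *
               (\<Sum>a\<in>K. cnj (add_character L K (a \<otimes>\<^bsub>L\<^esub> c)) *
                  (\<Sum>x\<in>carrier L - {\<zero>\<^bsub>L\<^esub>}.
                     add_character L (carrier L) (a \<otimes>\<^bsub>L\<^esub> x [^]\<^bsub>L\<^esub> ((q ^ m - 1) div N * d)))))
        \<and>
        of_nat N / (of_nat q * (of_nat q ^ m - 1)) *
            (\<Sum>d | d dvd N. of_int (moebius_mu d) / of_nat d *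
               (\<Sum>a\<in>K. cnj (add_character L K (a \<otimes>\<^bsub>L\<^esub> c)) *
                  (\<Sum>x\<in>carrier L - {\<zero>\<^bsub>L\<^esub>}.
                     add_character L (carrier L) (a \<otimes>\<^bsub>L\<^esub> x [^]\<^bsub>L\<^esub> ((q ^ m - 1) div N * d))))) =
          1 / of_nat q *
            (of_nat (totient N) +
             (\<Sum>i = 0..q - 2. cnj (add_character L K (\<alpha> [^]\<^bsub>L\<^esub> (Q * i) \<otimes>\<^bsub>L\<^esub> c)) *
                (\<Sum>d | d dvd N. of_int (moebius_mu d) *
                   gaussian_period L \<alpha> ((q ^ m - 1) div N * d) (int (Q * i))))))"
proof -
  interpret L: field L by fact
  have q: "q > 1" using \<open>primepow q\<close> primepow_gt_Suc_0[of q] by simp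
  then have qm: "q ^ m > 1" using \<open>m > 0\<close> by (rule one_less_power)
  interpret L: finite_field L
  proof
    show "finite (carrier L)"
      by (rule card_ge_0_finite) (use q \<open>order L = q ^ m\<close> in \<open>simp add: order_def\<close>)
  qed
  have M: "order L - 1 = q ^ m - 1" using \<open>order L = q ^ m\<close> by simp
  have N: "N > 0" "N dvd order L - 1" unfolding M by fact+
  have Q: "order L - 1 = Q * (card K - 1)"
    unfolding M \<open>card K = q\<close> \<open>Q = _\<close> using pred_dvd_power_pred by simp
  have cast: "real (q ^ m - 1) = real q ^ m - 1"
      "(of_nat (q ^ m - 1) :: complex) = of_nat q ^ m - 1"
    using qm by (simp_all add: of_nat_diff)
  have range: "{0..q - 2} = {..<card K - 1}" using q \<open>card K = q\<close> by auto
  note part1 = L.card_elements_of_order_in[OF N, where 'c = real, unfolded M cast]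
  note part2 = L.card_elements_of_order_with_trace[OF \<open>subfield K L\<close> _ N, unfolded M cast \<open>card K = q\<close>]
  note part3 = L.trace_sum_eq_gaussian_periods[OF \<open>primitive_element L \<alpha>\<close> \<open>subfield K L\<close> _ N Q,
      folded range, unfolded M cast \<open>card K = q\<close>]
  show ?thesis
    by (intro conjI allI ballI impI; (rule part1 | rule part2 | rule part3); assumption)
qed

end
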